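(* For all $x>0$, $$\frac{\sinh_p(x)}{x}<\frac{\cosh_p(x)+p}{1+p}\quad\text{if } p\in(1,2],$$ and $$\frac{\sinh_p(x)}{x}<\frac{\cosh_p(x)+2}{3}\quad\text{if } p\in[2,\infty).$$
   Context: For $1<p<\infty$ define $\mathrm{arcsinh}_p(x)=\int_0^x (1+t^p)^{-1/p}\,dt$ for $x\ge 0$. The generalized hyperbolic sine $\sinh_p:[0,\infty)\to[0,\infty)$ is the inverse of $\mathrm{arcsinh}_p$, and the generalized hyperbolic cosine is $\cosh_p(x)=\frac{d}{dx}\sinh_p(x)$; it satisfies $\cosh_p(x)^p-\sinh_p(x)^p=1$ for $x\ge0$. *)

theory Defs
  imports "HOL-Analysis.Analysis"
begin

text \<open>The parameter \<open>p\<close> is meant to satisfy \<open>1 < p\<close> and all functions are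
  meant on \<open>[0,\<infinity>)\<close>; their values elsewhere are irrelevant. Note \<open>0 powr p = 0\<close>,
  so the integrand is \<open>1\<close> at \<open>t = 0\<close>, as it should be.\<close>

definition arcsinh_p :: "real \<Rightarrow> real \<Rightarrow> real" where
  "arcsinh_p p x = integral {0..x} (\<lambda>t. (1 + t powr p) powr (- 1 / p))"

text \<open>For \<open>p > 1\<close>, \<open>arcsinh_p p\<close> is a bijection of \<open>[0,\<infinity>)\<close> onto itself (the integrand
  is positive and behaves like \<open>1 / t\<close> at infinity), so that \<open>inv_into\<close> is the genuine
  inverse.\<close>

definition sinh_p :: "real \<Rightarrow> real \<Rightarrow> real" where
  "sinh_p p = inv_into {0..} (arcsinh_p p)"

text \<open>The derivative is taken within \<open>[0,\<infinity>)\<close>, the domain of \<open>sinh_p p\<close>: it is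
  the ordinary derivative for \<open>x > 0\<close> and the right derivative at \<open>0\<close>.\<close>

definition cosh_p :: "real \<Rightarrow> real \<Rightarrow> real" where
  "cosh_p p x = vector_derivative (sinh_p p) (at x within {0..})"

end

theory Submission
  imports Defs
begin

text \<open>Put \<open>s = sinh_p x\<close> and \<open>c = (1 + s\<^sup>p)\<^bsup>1/p\<^esup> = cosh_p x\<close>. The claim is
  \<open>arcsinh_p s > (1 + k) s / (c + k)\<close> with \<open>k = p\<close> or \<open>k = 2\<close>. Both sides vanish at \<open>0\<close>, and since
  \<open>c' = s\<^bsup>p-1\<^esup> c\<^bsup>1-p\<^esup>\<close> and \<open>s\<^sup>p = c\<^sup>p - 1\<close>, comparing derivatives leaves
  \<open>(1 + k) (k c + c\<^bsup>2-p\<^esup>) < (c + k)\<^sup>2\<close> for \<open>c > 1\<close>. Bounding \<open>c\<^bsup>2-p\<^esup>\<close> by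
  \<open>1 + (2 - p) (c - 1)\<close> for \<open>p \<le> 2\<close> (Bernoulli) and by \<open>1\<close> for \<open>p \<ge> 2\<close>, the difference of the two
  sides is at least \<open>(c - 1)\<^sup>2\<close>.\<close>

text \<open>Weighted arithmetic-geometric mean of \<open>c\<close> and \<open>1\<close> with weights
  \<open>a\<close> and \<open>1 - a\<close>.\<close>

lemma powr_le_Bernoulli:
  fixes c a :: real
  assumes "0 < c" "0 \<le> a" "a \<le> 1"
  shows "c powr a \<le> 1 + a * (c - 1)"
proof -
  have "c powr a * 1 powr (1 - a) \<le> a * c + (1 - a) * 1"
    using assms by (intro Youngs_inequality_0) auto
  then show ?thesis by (simp add: algebra_simps)
qed

section \<open>Calculus of \<open>arcsinh_p\<close>\<close>

lemma one_plus_powr_pos [simp]: "0 < 1 + (s::real) powr p"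
  using powr_ge_zero[of s p] by linarith

lemma one_plus_powr_neq_0 [simp]: "1 + (s::real) powr p \<noteq> 0"
  using one_plus_powr_pos[of s p] by linarith

lemma continuous_on_one_plus_powr:
  fixes p a :: real
  assumes "0 < p"
  shows "continuous_on {0..} (\<lambda>t. (1 + t powr p) powr a)"
proof -
  have "continuous_on {0..} (\<lambda>t::real. t powr p)"
    using assms by (intro continuous_on_powr' continuous_intros) auto
  then show ?thesis
    by (rule continuous_on_powr[OF continuous_on_add[OF continuous_on_const] continuous_on_const]) simp
qed

lemma arcsinh_p_has_derivative_within:
  assumes "0 < p" "0 \<le> s"
  shows "(arcsinh_p p has_real_derivative (1 + s powr p) powr (- 1 / p)) (at s within {0..})"
proof -
  have "continuous_on {0..s + 1} (\<lambda>t. (1 + t powr p) powr (- 1 / p))"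
    using continuous_on_one_plus_powr[OF assms(1)] by (rule continuous_on_subset) auto
  then have "(arcsinh_p p has_real_derivative (1 + s powr p) powr (- 1 / p)) (at s within {0..s + 1})"
    unfolding arcsinh_p_def[abs_def] using assms
    by (intro integral_has_real_derivative) auto
  \<comment> \<open>The right end \<open>s + 1\<close> leaves room beyond \<open>s\<close>, so both
    sets agree near \<open>s\<close>; this also covers the one-sided derivative at
    \<open>0\<close>.\<close>
  moreover have "at s within {0..s + 1} = at s within {0..}"
    by (rule at_within_nhd[where S = "{..<s + 1}"]) auto
  ultimately show ?thesis by simp
qed

lemma arcsinh_p_has_derivative:
  assumes "0 < p" "0 < s"
  shows "(arcsinh_p p has_real_derivative (1 + s powr p) powr (- 1 / p)) (at s)"
  using arcsinh_p_has_derivative_within[of p s] at_within_interior[of s "{0..}"] assms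
  by simp

lemma continuous_on_arcsinh_p:
  assumes "0 < p"
  shows "continuous_on {0..} (arcsinh_p p)"
  by (rule DERIV_continuous_on, rule arcsinh_p_has_derivative_within) (use assms in auto)

lemma arcsinh_p_0 [simp]: "arcsinh_p p 0 = 0"
  by (simp add: arcsinh_p_def)

lemma strict_mono_on_arcsinh_p:
  assumes "0 < p"
  shows "strict_mono_on {0..} (arcsinh_p p)"
proof (rule strict_mono_onI)
  fix r s :: real assume rs: "r \<in> {0..}" "s \<in> {0..}" "r < s"
  show "arcsinh_p p r < arcsinh_p p s"
  proof (rule DERIV_pos_imp_increasing_open[OF rs(3)])
    show "\<exists>y. DERIV (arcsinh_p p) t :> y \<and> 0 < y" if "r < t" "t < s" for t
      using arcsinh_p_has_derivative[of p t] that rs assms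
      by (intro exI[of _ "(1 + t powr p) powr (- 1 / p)"]) (auto simp: less_le)
    show "continuous_on {r..s} (arcsinh_p p)"
      using continuous_on_arcsinh_p[OF assms] by (rule continuous_on_subset) (use rs in auto)
  qed
qed

section \<open>Bijectivity of \<open>arcsinh_p\<close> on the half-line\<close>

text \<open>Split \<open>(1 + s) powr p\<close> as \<open>(1 + s) powr (p - 1)\<close> plus
  \<open>s * (1 + s) powr (p - 1)\<close> and bound each summand from below by monotonicity. This
  bounds the integrand of \<open>arcsinh_p\<close> from below by \<open>1 / (1 + t)\<close>.\<close>

lemma one_plus_powr_le:
  fixes s p :: real
  assumes "1 \<le> p" "0 \<le> s"
  shows "1 + s powr p \<le> (1 + s) powr p"
proof -
  have *: "t powr p = t * t powr (p - 1)" if "0 \<le> t" for t :: real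
    using that assms by (cases "t = 0") (auto simp: powr_diff)
  have "s * s powr (p - 1) \<le> s * (1 + s) powr (p - 1)"
    using assms by (intro mult_left_mono powr_mono2) auto
  moreover have "1 \<le> (1 + s) powr (p - 1)"
    using assms by (intro ge_one_powr_ge_zero) auto
  ultimately show ?thesis
    using assms *[of s] *[of "1 + s"] by (simp add: algebra_simps)
qed

text \<open>This makes \<open>arcsinh_p p\<close> unbounded, hence onto \<open>[0,\<infinity>)\<close>.\<close>

lemma ln_le_arcsinh_p:
  assumes "1 \<le> p" "0 \<le> s"
  shows "ln (1 + s) \<le> arcsinh_p p s"
proof -
  have "arcsinh_p p 0 - ln (1 + 0) \<le> arcsinh_p p s - ln (1 + s)"
  proof (rule DERIV_nonneg_imp_increasing_open[OF assms(2)])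
    fix t assume t: "0 < t" "t < s"
    have "(1 + t powr p) powr (1 / p) \<le> ((1 + t) powr p) powr (1 / p)"
      using assms t one_plus_powr_le[of p t] by (intro powr_mono2) auto
    also have "\<dots> = 1 + t"
      using assms t by (simp add: powr_powr)
    finally have "1 / (1 + t) \<le> (1 + t powr p) powr (- 1 / p)"
      using t by (simp add: powr_minus_divide frac_le less_le)
    moreover have "((\<lambda>t. arcsinh_p p t - ln (1 + t)) has_real_derivative
        (1 + t powr p) powr (- 1 / p) - 1 / (1 + t)) (at t)"
      using t assms by (auto intro!: derivative_eq_intros arcsinh_p_has_derivative)
    ultimately show "\<exists>y. DERIV (\<lambda>t. arcsinh_p p t - ln (1 + t)) t :> y \<and> 0 \<le> y"
      by (intro exI conjI) auto
  next
    have "continuous_on {0..s} (arcsinh_p p)"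
      by (rule continuous_on_subset[OF continuous_on_arcsinh_p]) (use assms in auto)
    then show "continuous_on {0..s} (\<lambda>t. arcsinh_p p t - ln (1 + t))"
      by (intro continuous_intros) auto
  qed
  then show ?thesis by simp
qed

lemma bij_betw_arcsinh_p:
  assumes "1 \<le> p"
  shows "bij_betw (arcsinh_p p) {0..} {0..}"
proof (rule bij_betw_imageI)
  have mono: "strict_mono_on {0..} (arcsinh_p p)"
    using assms by (intro strict_mono_on_arcsinh_p) auto
  then show "inj_on (arcsinh_p p) {0..}"
    by (rule strict_mono_on_imp_inj_on)
  show "arcsinh_p p ` {0..} = {0..}"
  proof (intro equalityI subsetI)
    fix y assume "y \<in> arcsinh_p p ` {0..}"
    then obtain s where "0 \<le> s" "y = arcsinh_p p s" by auto
    then show "y \<in> {0..}"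
      using order_trans[OF ln_ge_zero ln_le_arcsinh_p[OF assms, of s]] by simp
  next
    fix y :: real assume y: "y \<in> {0..}"
    \<comment> \<open>The right end solves \<open>ln (1 + s) = y\<close>, so the logarithmic lower
      bound gives a value of at least \<open>y\<close> there.\<close>
    have "\<exists>s\<ge>0. s \<le> exp y - 1 \<and> arcsinh_p p s = y"
    proof (rule IVT')
      show "y \<le> arcsinh_p p (exp y - 1)"
        using ln_le_arcsinh_p[OF assms, of "exp y - 1"] y by simp
      show "continuous_on {0..exp y - 1} (arcsinh_p p)"
        by (rule continuous_on_subset[OF continuous_on_arcsinh_p]) (use assms in auto)
    qed (use y in auto)
    then show "y \<in> arcsinh_p p ` {0..}" by auto
  qed
qed

section \<open>The inverse \<open>sinh_p\<close> and its derivative \<open>cosh_p\<close>\<close>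

lemma sinh_p_arcsinh_p:
  assumes "1 \<le> p" "0 \<le> s"
  shows "sinh_p p (arcsinh_p p s) = s"
  using bij_betw_inv_into_left[OF bij_betw_arcsinh_p[OF assms(1)]] assms
  by (simp add: sinh_p_def)

lemma arcsinh_p_sinh_p:
  assumes "1 \<le> p" "0 \<le> x"
  shows "arcsinh_p p (sinh_p p x) = x"
  using bij_betw_inv_into_right[OF bij_betw_arcsinh_p[OF assms(1)]] assms
  by (simp add: sinh_p_def)

lemma sinh_p_pos:
  assumes "1 \<le> p" "0 < x"
  shows "0 < sinh_p p x"
proof -
  have "sinh_p p x \<in> {0..}"
    using bij_betw_apply[OF bij_betw_inv_into[OF bij_betw_arcsinh_p[OF assms(1)]], of x] assms
    by (simp add: sinh_p_def)
  moreover have "sinh_p p x \<noteq> 0"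
    using arcsinh_p_sinh_p[of p x] assms by auto
  ultimately show ?thesis by auto
qed

lemma sinh_p_has_derivative:
  assumes "1 \<le> p" "0 < x"
  shows "(sinh_p p has_real_derivative (1 + sinh_p p x powr p) powr (1 / p)) (at x)"
proof -
  let ?s = "sinh_p p x"
  have s: "0 < ?s" using sinh_p_pos assms by auto
  have "isCont (sinh_p p) (arcsinh_p p ?s)"
  \<comment> \<open>The radius \<open>?s / 2\<close> keeps the neighbourhood of \<open>?s\<close>
    inside the positive reals, where \<open>arcsinh_p\<close> is differentiable and
    \<open>sinh_p\<close> inverts it.\<close>
  proof (rule isCont_inverse_function[of "?s / 2" ?s _ "arcsinh_p p"])
    have z: "0 < z" if "\<bar>z - ?s\<bar> \<le> ?s / 2" for z
      using that s by (simp add: abs_if split: if_splits)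
    show "sinh_p p (arcsinh_p p z) = z" if "\<bar>z - ?s\<bar> \<le> ?s / 2" for z
      using z[OF that] assms by (simp add: sinh_p_arcsinh_p)
    show "isCont (arcsinh_p p) z" if "\<bar>z - ?s\<bar> \<le> ?s / 2" for z
      using z[OF that] assms by (intro DERIV_isCont[OF arcsinh_p_has_derivative]) auto
  qed (use s in auto)
  then have "isCont (sinh_p p) x" using assms by (simp add: arcsinh_p_sinh_p)
  moreover have "(1 + ?s powr p) powr (- 1 / p) \<noteq> 0"
    by simp
  ultimately have "(sinh_p p has_real_derivative inverse ((1 + ?s powr p) powr (- 1 / p))) (at x)"
    using assms s arcsinh_p_has_derivative[of p ?s]
    by (intro DERIV_inverse_function[of "arcsinh_p p" _ _ _ 0 "x + 1"])
       (auto simp: arcsinh_p_sinh_p)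
  then show ?thesis by (simp add: powr_minus)
qed

text \<open>This is the identity \<open>cosh_p p x powr p - sinh_p p x powr p = 1\<close> solved for
  \<open>cosh_p\<close>; it comes from the inverse function rule.\<close>

lemma cosh_p_eq:
  assumes "1 \<le> p" "0 < x"
  shows "cosh_p p x = (1 + sinh_p p x powr p) powr (1 / p)"
proof -
  have "at x within {0..} = at x"
    using at_within_interior[of x "{0..}"] assms by simp
  then show ?thesis
    unfolding cosh_p_def
    using sinh_p_has_derivative[OF assms]
    by (simp add: vector_derivative_at has_real_derivative_iff_has_vector_derivative)
qed

section \<open>Comparison of derivatives and the two inequalities\<close>

text \<open>Serves both ranges of \<open>p\<close> at once: \<open>key\<close> says that the
  difference of the two sides has positive derivative, with denominators cleared and everything
  expressed in \<open>c\<close>.\<close>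

lemma arcsinh_p_gt:
  fixes p k s :: real
  assumes p: "1 \<le> p" and k: "0 \<le> k" and s: "0 < s"
    and key: "\<And>c. 1 < c \<Longrightarrow> (1 + k) * (k * c + c powr (2 - p)) < (c + k)\<^sup>2"
  shows "(1 + k) * s / ((1 + s powr p) powr (1 / p) + k) < arcsinh_p p s"
proof -
  define c where "c t = (1 + t powr p) powr (1 / p)" for t :: real
  have c_pos: "0 < c t" for t
    by (simp add: c_def less_le)
  have "arcsinh_p p 0 - (1 + k) * 0 / (c 0 + k) < arcsinh_p p s - (1 + k) * s / (c s + k)"
  proof (rule DERIV_pos_imp_increasing_open[OF s])
    fix t assume t: "0 < t" "t < s"
    have c_powr: "c t powr a = (1 + t powr p) powr (a / p)" for a
      by (simp add: c_def powr_powr)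
    have c1: "1 < c t"
      unfolding c_def using t p by (intro gr_one_powr) auto
    have cp: "c t powr p = 1 + t powr p"
      using p by (simp add: c_powr)
    have dc: "(c has_real_derivative t powr (p - 1) * c t powr (1 - p)) (at t)"
      unfolding c_powr unfolding c_def[abs_def] using t p
      by (auto intro!: derivative_eq_intros simp: diff_divide_distrib)
    have dA: "(arcsinh_p p has_real_derivative 1 / c t) (at t)"
      using arcsinh_p_has_derivative[of p t] t p by (simp add: c_def powr_minus_divide)
    have nz: "c t + k \<noteq> 0" using c_pos[of t] k by linarith
    have "((\<lambda>t. arcsinh_p p t - (1 + k) * t / (c t + k)) has_real_derivative
        1 / c t - ((1 + k) * (c t + k) - (1 + k) * t * (t powr (p - 1) * c t powr (1 - p)))
          / ((c t + k) * (c t + k))) (at t)"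
      (is "(_ has_real_derivative ?D) _")
      using DERIV_diff[OF dA DERIV_divide[OF DERIV_cmult[OF DERIV_ident] DERIV_add[OF dc DERIV_const] nz]]
      by simp
    moreover have "0 < ?D"
    proof -
      \<comment> \<open>Eliminates \<open>t\<close> from the numerator: \<open>t powr p\<close> is
        replaced by \<open>c t powr p - 1\<close>.\<close>
      have "t * (t powr (p - 1) * c t powr (1 - p)) = t powr p * (c t / c t powr p)"
        using t c_pos[of t] by (simp add: powr_diff)
      also have "\<dots> = c t - c t powr (1 - p)"
        using c_pos[of t] by (simp add: powr_diff cp field_simps)
      finally have "(1 + k) * (c t + k) - (1 + k) * t * (t powr (p - 1) * c t powr (1 - p)) =
          (1 + k) * (c t + k) - (1 + k) * (c t - c t powr (1 - p))"
        by (simp only: mult.assoc)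
      also have "\<dots> = (1 + k) * (k + c t powr (1 - p))"
        by (simp add: algebra_simps)
      finally have N: "(1 + k) * (c t + k) - (1 + k) * t * (t powr (p - 1) * c t powr (1 - p)) =
          (1 + k) * (k + c t powr (1 - p))" .
      \<comment> \<open>Multiplying by \<open>c t\<close>, the denominator of the derivative of
        \<open>arcsinh_p\<close>, brings the numerator to the form in \<open>key\<close>.\<close>
      have "c t powr (1 - p) * c t = c t powr (2 - p)"
        using powr_mult_base[of "c t" "1 - p"] c_pos[of t] by (simp add: mult.commute)
      then have "(1 + k) * (k + c t powr (1 - p)) * c t = (1 + k) * (k * c t + c t powr (2 - p))"
        by (simp only: mult.assoc distrib_right)
      also have "\<dots> < (c t + k) * (c t + k)"
        using key[OF c1] by (simp only: power2_eq_square)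
      finally have "(1 + k) * (k + c t powr (1 - p)) < (c t + k) * (c t + k) / c t"
        using c_pos[of t] by (simp only: pos_less_divide_eq)
      moreover have "0 < (c t + k) * (c t + k)"
        using nz by (simp only: zero_less_mult_iff) linarith
      ultimately show ?thesis
        unfolding N by (simp add: pos_divide_less_eq)
    qed
    ultimately show "\<exists>y. DERIV (\<lambda>t. arcsinh_p p t - (1 + k) * t / (c t + k)) t :> y \<and> 0 < y"
      by blast
  next
    have "continuous_on {0..s} (arcsinh_p p)"
      by (rule continuous_on_subset[OF continuous_on_arcsinh_p]) (use p in auto)
    moreover have "continuous_on {0..s} c"
      unfolding c_def[abs_def]
      by (rule continuous_on_subset[OF continuous_on_one_plus_powr]) (use p in auto)
    moreover have "c t + k \<noteq> 0" for t using c_pos[of t] k by linarith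
    ultimately show "continuous_on {0..s} (\<lambda>t. arcsinh_p p t - (1 + k) * t / (c t + k))"
      by (intro continuous_intros) auto
  qed
  then show ?thesis by (simp add: c_def)
qed

text \<open>Take \<open>s = sinh_p p x\<close> in the preceding bound, so that
  \<open>arcsinh_p p s\<close> is \<open>x\<close>, and clear the positive denominators.\<close>

lemma sinh_p_div_less:
  fixes p k x :: real
  assumes p: "1 \<le> p" and k: "0 \<le> k" and x: "0 < x"
    and key: "\<And>c. 1 < c \<Longrightarrow> (1 + k) * (k * c + c powr (2 - p)) < (c + k)\<^sup>2"
  shows "sinh_p p x / x < (cosh_p p x + k) / (1 + k)"
proof -
  have "0 < cosh_p p x"
    unfolding cosh_p_eq[OF p x] by (simp add: less_le)
  moreover have "(1 + k) * sinh_p p x / (cosh_p p x + k) < x"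
    using arcsinh_p_gt[OF p k sinh_p_pos[OF p x] key] p x
    by (simp add: cosh_p_eq arcsinh_p_sinh_p)
  ultimately show ?thesis using x k by (simp add: field_simps)
qed

theorem theorem3p24:
  fixes p x :: real
  assumes "1 < p" and "0 < x"
  shows "(p \<in> {1<..2} \<longrightarrow> sinh_p p x / x < (cosh_p p x + p) / (1 + p)) \<and>
         (p \<in> {2..} \<longrightarrow> sinh_p p x / x < (cosh_p p x + 2) / 3)"
proof (intro conjI impI)
  assume p: "p \<in> {1<..2}"
  show "sinh_p p x / x < (cosh_p p x + p) / (1 + p)"
  proof (rule sinh_p_div_less)
    fix c :: real assume c: "1 < c"
    \<comment> \<open>With this bound inserted, the right side minus the left side is exactly
      \<open>(c - 1)\<close> squared.\<close>
    have "(1 + p) * c powr (2 - p) \<le> (1 + p) * (1 + (2 - p) * (c - 1))"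
      using p c by (intro mult_left_mono powr_le_Bernoulli) auto
    moreover have "0 < (c - 1)\<^sup>2" using c by simp
    ultimately show "(1 + p) * (p * c + c powr (2 - p)) < (c + p)\<^sup>2"
      by (simp add: power2_eq_square algebra_simps)
  qed (use assms in auto)
next
  assume p: "p \<in> {2..}"
  have "sinh_p p x / x < (cosh_p p x + 2) / (1 + 2)"
  proof (rule sinh_p_div_less)
    fix c :: real assume c: "1 < c"
    \<comment> \<open>The exponent is nonpositive and \<open>c > 1\<close>. Replacing the power by
      \<open>1\<close> again leaves exactly \<open>(c - 1)\<close> squared.\<close>
    have "c powr (2 - p) \<le> c powr 0"
      using p c by (intro powr_mono) auto
    moreover have "0 < (c - 1)\<^sup>2" using c by simp
    ultimately show "(1 + 2) * (2 * c + c powr (2 - p)) < (c + 2)\<^sup>2"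
      using c by (simp add: power2_eq_square algebra_simps)
  qed (use assms in auto)
  then show "sinh_p p x / x < (cosh_p p x + 2) / 3" by simp
qed

end
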